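(* Consider the single index model $Y_i=g(\beta'X_i,\varepsilon_i)$, $i=1,\dots,n$, and suppose that Assumptions 1 and 2 (written out in the context) are satisfied. Let $\theta^0=\arg\min_{\theta\in\mathbb{R}^p}\mathbb{E}\,Q(\theta)$, let $\mu=\mathbb{E}[\mathbb{I}(Y_2\le Y_1)X_1]$, and let $F$ be the cumulative distribution function of $Y_1$. Then $$\theta^0=\gamma_\beta\,\beta,\qquad \gamma_\beta=\frac{\frac{n-1}{n}\,\beta'\mu}{\beta'H\beta}=\frac{\frac{n-1}{n}\,\mathrm{Cov}(F(Y_1),\beta'X_1)}{\beta'H\beta}.$$ Additionally, if $F$ is increasing and $g$ is increasing with respect to its first argument, then $\gamma_\beta>0$, so the signs of the coordinates of $\beta$ coincide with the signs of the corresponding coordinates of $\theta^0$, and $$\{j:\beta_j\ne0\}=\{j:\theta^0_j\neq 0\}.$$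
   Context: Model: $n\ge2$, $p\ge1$, $\beta\in\mathbb{R}^p$ with $\beta\neq0$; $Y_i=g(\beta'X_i,\varepsilon_i)\in\mathbb{R}$, $i=1,\dots,n$, where $X_i\in\mathbb{R}^p$ are random predictors, $\varepsilon_i$ are noise random variables and $g$ is an (unknown, measurable) function. Here $'$ denotes transpose. "Increasing" means strictly increasing. Assumption 1: $(X_1,\varepsilon_1),\dots,(X_n,\varepsilon_n)$ are i.i.d.; the distribution of $X_1$ is absolutely continuous; $X_1$ is independent of $\varepsilon_1$; $\mathbb{E}X_1=0$; $H=\mathbb{E}X_1X_1'$ is positive definite with $H_{jj}=1$ for $j=1,\dots,p$. Assumption 2: for each $\theta\in\mathbb{R}^p$ the conditional expectation $\mathbb{E}(\theta'X_1\mid\beta'X_1)$ exists and equals $d_\theta\,\beta'X_1$ for some real number $d_\theta$. Ranks: $R_i=\sum_{j=1}^n\mathbb{I}(Y_j\le Y_i)$, where $\mathbb{I}$ is the indicator function. Loss: $Q(\theta)=\frac1{2n}\sum_{i=1}^n\left(R_i/n-0.5-\theta'X_i\right)^2$. *)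

theory Defs
  imports "HOL-Probability.Probability"
begin

definition outer_prod :: "real ^ 'p \<Rightarrow> real ^ 'p \<Rightarrow> real ^ 'p ^ 'p" where
  "outer_prod x y = (\<chi> i j. x $ i * y $ j)"

definition pos_definite :: "real ^ 'p ^ 'p \<Rightarrow> bool" where
  "pos_definite A \<longleftrightarrow> transpose A = A \<and> (\<forall>v. v \<noteq> 0 \<longrightarrow> v \<bullet> (A *v v) > 0)"

definition covariance :: "'a measure \<Rightarrow> ('a \<Rightarrow> real) \<Rightarrow> ('a \<Rightarrow> real) \<Rightarrow> real" where
  "covariance M U V =
     (\<integral>\<omega>. (U \<omega> - (\<integral>\<omega>'. U \<omega>' \<partial>M)) * (V \<omega> - (\<integral>\<omega>'. V \<omega>' \<partial>M)) \<partial>M)"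

definition cond_exp_given :: "'a measure \<Rightarrow> ('a \<Rightarrow> real) \<Rightarrow> ('a \<Rightarrow> real) \<Rightarrow> 'a \<Rightarrow> real" where
  "cond_exp_given M U Z = real_cond_exp M (vimage_algebra (space M) Z borel) U"

text \<open>The library's \<open>indep_var\<close> forces both random variables to have the same range type.\<close>

definition indep_rvs ::
  "'a measure \<Rightarrow> 'b measure \<Rightarrow> ('a \<Rightarrow> 'b) \<Rightarrow> 'c measure \<Rightarrow> ('a \<Rightarrow> 'c) \<Rightarrow> bool" where
  "indep_rvs M K U L V \<longleftrightarrow>
     U \<in> measurable M K \<and> V \<in> measurable M L \<and>
     prob_space.indep_set M (sets (vimage_algebra (space M) U K))
                            (sets (vimage_algebra (space M) V L))"

definition sample_rank :: "nat \<Rightarrow> (nat \<Rightarrow> real) \<Rightarrow> nat \<Rightarrow> nat" where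
  "sample_rank n y i = (\<Sum>j=1..n. of_bool (y j \<le> y i))"

text \<open>The least-squares loss for centred ranks, as a function of a realised sample
  \<open>(x 1, y 1), \<dots>, (x n, y n)\<close>; its random version is obtained by inserting
  \<open>X i \<omega>\<close> and \<open>Y i \<omega>\<close>.\<close>

definition rank_loss ::
  "nat \<Rightarrow> (nat \<Rightarrow> real ^ 'p) \<Rightarrow> (nat \<Rightarrow> real) \<Rightarrow> real ^ 'p \<Rightarrow> real" where
  "rank_loss n x y \<theta> =
     1 / (2 * real n) *
     (\<Sum>i=1..n. (real (sample_rank n y i) / real n - 1 / 2 - \<theta> \<bullet> x i)\<^sup>2)"

end

theory Submission
  imports Defs
begin

text \<open>Write \<open>Z = \<beta> \<bullet> X\<^sub>1\<close>. Since the ranks are sums of comparisons \<open>Y\<^sub>j \<le> Y\<^sub>i\<close> and each diagonal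
  term \<open>j = i\<close> contributes \<open>E (\<theta> \<bullet> X\<^sub>i) = 0\<close>, the expected loss is, up to a constant, the quadratic
  \<open>\<theta> \<bullet> H \<theta> / 2 - (n - 1) / n * (\<theta> \<bullet> \<mu>)\<close>, where \<open>\<theta> \<bullet> \<mu> = E (F (Y\<^sub>1) (\<theta> \<bullet> X\<^sub>1))\<close> by Fubini.
  Conditioning on \<open>Z\<close> gives both \<open>\<theta> \<bullet> \<mu> = d (\<beta> \<bullet> \<mu>)\<close> and \<open>\<theta> \<bullet> H \<beta> = d (\<beta> \<bullet> H \<beta>)\<close> with the same
  \<open>d\<close>, so the linear term equals \<open>\<theta> \<bullet> H (\<gamma> \<beta>)\<close> and completing the square yields the minimiser.
  For the sign, \<open>F (g 0 \<epsilon>\<^sub>1)\<close> is independent of the centred \<open>Z\<close>, so \<open>\<beta> \<bullet> \<mu>\<close> is the expectation of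
  \<open>(F (g Z \<epsilon>\<^sub>1) - F (g 0 \<epsilon>\<^sub>1)) Z\<close>, which is positive wherever \<open>Z \<noteq> 0\<close>.\<close>


section \<open>Independence and conditional expectation\<close>

lemma measurable_funcset: "f \<in> measurable M N \<Longrightarrow> f \<in> space M \<rightarrow> space N"
  by (auto dest: measurable_space)

lemma integrable_bounded_mult:
  fixes M :: "'a measure" and f h :: "'a \<Rightarrow> real"
  assumes "integrable M h" "f \<in> borel_measurable M" "\<And>\<omega>. \<bar>f \<omega>\<bar> \<le> C"
  shows "integrable M (\<lambda>\<omega>. f \<omega> * h \<omega>)"
proof (rule Bochner_Integration.integrable_bound)
  show "integrable M (\<lambda>\<omega>. C * h \<omega>)" using assms by auto
  show "(\<lambda>\<omega>. f \<omega> * h \<omega>) \<in> borel_measurable M" using assms by auto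
  show "AE \<omega> in M. norm (f \<omega> * h \<omega>) \<le> norm (C * h \<omega>)"
    using assms(3) order_trans[OF assms(3) abs_ge_self]
    by (auto simp: abs_mult intro!: mult_right_mono)
qed

context prob_space
begin

text \<open>Both sides are finite measures on the product sigma-algebra, so agreement on rectangles
  is enough, and on rectangles independence of the generated sigma-algebras is the product rule. The
  two range types may differ.\<close>

lemma distr_pair_indep_rvs:
  assumes "indep_rvs M K U L V"
  shows "distr M K U \<Otimes>\<^sub>M distr M L V = distr M (K \<Otimes>\<^sub>M L) (\<lambda>\<omega>. (U \<omega>, V \<omega>))"
proof (rule pair_measure_eqI)
  have U [measurable]: "U \<in> measurable M K" and V [measurable]: "V \<in> measurable M L"
    using assms by (auto simp: indep_rvs_def)
  show "sigma_finite_measure (distr M K U)" "sigma_finite_measure (distr M L V)"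
    by (rule prob_space_imp_sigma_finite[OF prob_space_distr], fact)+
  show "sets (distr M K U \<Otimes>\<^sub>M distr M L V) = sets (distr M (K \<Otimes>\<^sub>M L) (\<lambda>\<omega>. (U \<omega>, V \<omega>)))"
    by (simp cong: sets_pair_measure_cong)
  fix A B assume "A \<in> sets (distr M K U)" "B \<in> sets (distr M L V)"
  then have AB [measurable]: "A \<in> sets K" "B \<in> sets L" by auto
  have "prob ((U -` A \<inter> space M) \<inter> (V -` B \<inter> space M)) =
      prob (U -` A \<inter> space M) * prob (V -` B \<inter> space M)"
    using assms AB by (intro indep_setD[of "sets (vimage_algebra (space M) U K)"
          "sets (vimage_algebra (space M) V L)"]) (auto simp: indep_rvs_def intro: in_vimage_algebra)
  moreover have "(U -` A \<inter> space M) \<inter> (V -` B \<inter> space M) =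
      (\<lambda>\<omega>. (U \<omega>, V \<omega>)) -` (A \<times> B) \<inter> space M"
    by auto
  ultimately show "emeasure (distr M K U) A * emeasure (distr M L V) B =
      emeasure (distr M (K \<Otimes>\<^sub>M L) (\<lambda>\<omega>. (U \<omega>, V \<omega>))) (A \<times> B)"
    by (simp add: emeasure_distr emeasure_eq_measure flip: ennreal_mult)
qed

text \<open>Fubini for the joint law, which is a product by the previous lemma. Pulling the inner
  integral back to \<open>M\<close> lets \<open>V\<close> be evaluated at a separate outcome, as for
  an independent copy.\<close>

lemma indep_rvs_expectation:
  fixes h :: "'b \<times> 'c \<Rightarrow> real"
  assumes indep: "indep_rvs M K U L V"
    and h [measurable]: "h \<in> borel_measurable (K \<Otimes>\<^sub>M L)"
    and int: "integrable M (\<lambda>\<omega>. h (U \<omega>, V \<omega>))"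
  shows "expectation (\<lambda>\<omega>. h (U \<omega>, V \<omega>)) = (\<integral>\<omega>. \<integral>\<omega>'. h (U \<omega>, V \<omega>') \<partial>M \<partial>M)"
proof -
  have U [measurable]: "U \<in> measurable M K" and V [measurable]: "V \<in> measurable M L"
    using indep by (auto simp: indep_rvs_def)
  interpret PU: prob_space "distr M K U" by (rule prob_space_distr) simp
  interpret PV: prob_space "distr M L V" by (rule prob_space_distr) simp
  interpret UV: pair_sigma_finite "distr M K U" "distr M L V" ..
  have "integrable (distr M K U \<Otimes>\<^sub>M distr M L V) h"
    unfolding distr_pair_indep_rvs[OF indep] using int by (subst integrable_distr_eq) auto
  note Fubini = UV.integral_fst'[OF this]
  have "expectation (\<lambda>\<omega>. h (U \<omega>, V \<omega>)) = integral\<^sup>L (distr M K U \<Otimes>\<^sub>M distr M L V) h"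
    unfolding distr_pair_indep_rvs[OF indep] by (subst integral_distr) auto
  also have "\<dots> = (\<integral>x. \<integral>y. h (x, y) \<partial>distr M L V \<partial>distr M K U)"
    by (rule Fubini[symmetric])
  also have "\<dots> = (\<integral>\<omega>. \<integral>y. h (U \<omega>, y) \<partial>distr M L V \<partial>M)"
    by (subst integral_distr) auto
  also have "\<dots> = (\<integral>\<omega>. \<integral>\<omega>'. h (U \<omega>, V \<omega>') \<partial>M \<partial>M)"
  proof (rule Bochner_Integration.integral_cong[OF refl])
    fix \<omega> assume "\<omega> \<in> space M"
    then have "U \<omega> \<in> space K" by (rule measurable_space[OF U])
    then show "(\<integral>y. h (U \<omega>, y) \<partial>distr M L V) = (\<integral>\<omega>'. h (U \<omega>, V \<omega>') \<partial>M)"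
      by (subst integral_distr) auto
  qed
  finally show ?thesis .
qed

text \<open>Extracts from an independent family the two-variable form that Fubini needs. Generated
  events are preimages, so the product rule over the index set \<open>{i,j}\<close> applies
  directly.\<close>

lemma indep_vars_indep_rvs:
  assumes indep: "indep_vars N W I" and ij: "i \<in> I" "j \<in> I" "i \<noteq> j"
  shows "indep_rvs M (N i) (W i) (N j) (W j)"
proof -
  have W: "W i \<in> measurable M (N i)" "W j \<in> measurable M (N j)"
    using indep ij by (auto simp: indep_vars_def)
  have "prob (a \<inter> b) = prob a * prob b"
    if ab: "a \<in> sets (vimage_algebra (space M) (W i) (N i))"
      "b \<in> sets (vimage_algebra (space M) (W j) (N j))" for a b
  proof -
    obtain A B where AB: "A \<in> sets (N i)" "a = W i -` A \<inter> space M"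
        "B \<in> sets (N j)" "b = W j -` B \<inter> space M"
      using ab unfolding sets_vimage_algebra2[OF measurable_funcset[OF W(1)]]
        sets_vimage_algebra2[OF measurable_funcset[OF W(2)]] by blast
    have "prob (\<Inter>k\<in>{i,j}. W k -` (if k = i then A else B) \<inter> space M) =
        (\<Prod>k\<in>{i,j}. prob (W k -` (if k = i then A else B) \<inter> space M))"
      using indep ij AB by (intro indep_varsD) auto
    then show ?thesis using AB ij by auto
  qed
  then show ?thesis
    unfolding indep_rvs_def indep_sets2_eq
    using W sets_vimage_algebra2[OF measurable_funcset[OF W(1)]]
      sets_vimage_algebra2[OF measurable_funcset[OF W(2)]]
    by (auto intro: measurable_sets)
qed

text \<open>A weight that is a function of \<open>Z\<close> is measurable for the sigma-algebra
  generated by \<open>Z\<close>, so \<open>U\<close> may be replaced by its conditional expectation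
  under the integral. Integrability is asked of the weighted product.\<close>

lemma cond_exp_given_expectation:
  fixes U Z V :: "'a \<Rightarrow> real"
  assumes [measurable]: "U \<in> borel_measurable M" "Z \<in> borel_measurable M"
    "\<phi> \<in> borel_measurable borel"
    and int: "integrable M (\<lambda>\<omega>. \<phi> (Z \<omega>) * U \<omega>)"
    and eq: "AE \<omega> in M. cond_exp_given M U Z \<omega> = V \<omega>" and [measurable]: "V \<in> borel_measurable M"
  shows "expectation (\<lambda>\<omega>. \<phi> (Z \<omega>) * U \<omega>) = expectation (\<lambda>\<omega>. \<phi> (Z \<omega>) * V \<omega>)"
proof -
  let ?G = "vimage_algebra (space M) Z borel"
  have "subalgebra M ?G"
    unfolding subalgebra_def by (auto simp: sets_vimage_algebra2)
  then interpret finite_measure_subalgebra M ?G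
    by unfold_locales
  have [measurable]: "Z \<in> borel_measurable ?G"
    by (rule measurable_vimage_algebra1) auto
  have "expectation (\<lambda>\<omega>. \<phi> (Z \<omega>) * U \<omega>) =
      expectation (\<lambda>\<omega>. \<phi> (Z \<omega>) * real_cond_exp M ?G U \<omega>)"
    using int by (intro real_cond_exp_intg(2)[symmetric]) auto
  also have "\<dots> = expectation (\<lambda>\<omega>. \<phi> (Z \<omega>) * V \<omega>)"
    using eq by (intro integral_cong_AE) (auto simp: cond_exp_given_def)
  finally show ?thesis .
qed

end


section \<open>The expected rank loss\<close>

lemma inner_outer_prod: "u \<bullet> (outer_prod x y *v v) = (u \<bullet> x) * (v \<bullet> y)"
  by (simp add: inner_vec_def matrix_vector_mult_def outer_prod_def sum_distrib_left sum_distrib_right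
      mult_ac) (rule sum.swap)

text \<open>Allows the matrix-valued integral defining \<open>H\<close> to be taken through a
  bilinear form in fixed vectors.\<close>

lemma bounded_linear_inner_matrix_vector:
  fixes u :: "real ^ 'm" and v :: "real ^ 'k"
  shows "bounded_linear (\<lambda>A. u \<bullet> (A *v v))"
  unfolding linear_conv_bounded_linear[symmetric]
  by (rule linearI)
    (simp_all add: matrix_vector_mult_add_rdistrib inner_add_right scaleR_matrix_vector_assoc[symmetric])

locale single_index_sample = prob_space M
  for M :: "'a measure" +
  fixes n :: nat and X :: "nat \<Rightarrow> 'a \<Rightarrow> real ^ 'p" and \<epsilon> Y :: "nat \<Rightarrow> 'a \<Rightarrow> real"
    and g :: "real \<Rightarrow> real \<Rightarrow> real" and \<beta> \<mu> :: "real ^ 'p" and H :: "real ^ 'p ^ 'p"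
    and F :: "real \<Rightarrow> real"
  assumes n: "n \<ge> 2"
    and g_measurable: "(\<lambda>(t, e). g t e) \<in> borel_measurable borel"
    and model: "\<And>i \<omega>. i \<in> {1..n} \<Longrightarrow> Y i \<omega> = g (\<beta> \<bullet> X i \<omega>) (\<epsilon> i \<omega>)"
    and independent: "indep_vars (\<lambda>_. borel) (\<lambda>i \<omega>. (X i \<omega>, \<epsilon> i \<omega>)) {1..n}"
    and identically_distributed:
      "\<And>i. i \<in> {1..n} \<Longrightarrow>
         distr M borel (\<lambda>\<omega>. (X i \<omega>, \<epsilon> i \<omega>)) = distr M borel (\<lambda>\<omega>. (X 1 \<omega>, \<epsilon> 1 \<omega>))"
    and X_noise_indep: "indep_rvs M borel (X 1) borel (\<epsilon> 1)"
    and X_integrable: "integrable M (X 1)"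
    and X_centred: "expectation (X 1) = 0"
    and XX_integrable: "integrable M (\<lambda>\<omega>. outer_prod (X 1 \<omega>) (X 1 \<omega>))"
    and H: "H = (\<integral>\<omega>. outer_prod (X 1 \<omega>) (X 1 \<omega>) \<partial>M)"
    and \<mu>: "\<mu> = (\<integral>\<omega>. of_bool (Y 2 \<omega> \<le> Y 1 \<omega>) *\<^sub>R X 1 \<omega> \<partial>M)"
    and F: "F = cdf (distr M borel (Y 1))"
begin

section \<open>Measurability, identical distribution and moments of the predictors\<close>

lemma g_measurable_pair [measurable]: "(\<lambda>p. g (fst p) (snd p)) \<in> borel_measurable (borel \<Otimes>\<^sub>M borel)"
  using g_measurable by (simp add: borel_prod case_prod_beta')

lemma g_measurable_comp [measurable (raw)]:
  assumes [measurable]: "a \<in> borel_measurable N" "b \<in> borel_measurable N"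
  shows "(\<lambda>x. g (a x) (b x)) \<in> borel_measurable N"
  using measurable_compose[OF measurable_Pair[OF assms] g_measurable_pair] by simp

lemma pair_measurable:
  assumes "i \<in> {1..n}" shows "(\<lambda>\<omega>. (X i \<omega>, \<epsilon> i \<omega>)) \<in> borel_measurable M"
  using independent assms by (auto simp: indep_vars_def)

lemma X_measurable [measurable]: "i \<in> {1..n} \<Longrightarrow> X i \<in> borel_measurable M"
  and \<epsilon>_measurable [measurable]: "i \<in> {1..n} \<Longrightarrow> \<epsilon> i \<in> borel_measurable M"
  using measurable_compose[OF pair_measurable, of i fst borel]
    measurable_compose[OF pair_measurable, of i snd borel]
  by (auto simp flip: borel_prod)

lemma Y_measurable [measurable]:
  assumes [measurable]: "i \<in> {1..n}" shows "Y i \<in> borel_measurable M"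
  unfolding model[OF assms, abs_def] by measurable

text \<open>The index 1 must stay a literal; rewritten to \<open>Suc 0\<close>, terms such as
  \<open>X 1\<close> would no longer match the facts about them.\<close>

declare One_nat_def [simp del]

lemma n_ge [simp]: "0 < n" "1 < n" "1 \<le> n" "2 \<le> n"
  using n by auto

lemma one_mem: "1 \<in> {1..n}" and two_mem: "2 \<in> {1..n}"
  by auto

lemmas sample_measurable_1_2 [measurable] =
  X_measurable[OF one_mem] \<epsilon>_measurable[OF one_mem] Y_measurable[OF one_mem]
  Y_measurable[OF two_mem]

text \<open>Expectation and integrability depend only on the law of the pair. Since \<open>f\<close>
  sees predictor and noise together, this also covers functions of \<open>Y i\<close>.\<close>

lemma identically_distributed_transfer:
  fixes f :: "(real ^ 'p) \<times> real \<Rightarrow> real"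
  assumes i: "i \<in> {1..n}" and f [measurable]: "f \<in> borel_measurable (borel \<Otimes>\<^sub>M borel)"
  shows "expectation (\<lambda>\<omega>. f (X i \<omega>, \<epsilon> i \<omega>)) = expectation (\<lambda>\<omega>. f (X 1 \<omega>, \<epsilon> 1 \<omega>))"
    and "integrable M (\<lambda>\<omega>. f (X i \<omega>, \<epsilon> i \<omega>)) \<longleftrightarrow> integrable M (\<lambda>\<omega>. f (X 1 \<omega>, \<epsilon> 1 \<omega>))"
proof -
  have f': "f \<in> borel_measurable borel" using f by (simp add: borel_prod)
  note p = pair_measurable[OF i] pair_measurable[OF one_mem]
  show "expectation (\<lambda>\<omega>. f (X i \<omega>, \<epsilon> i \<omega>)) = expectation (\<lambda>\<omega>. f (X 1 \<omega>, \<epsilon> 1 \<omega>))"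
    using identically_distributed[OF i] integral_distr[OF p(1) f'] integral_distr[OF p(2) f'] by simp
  show "integrable M (\<lambda>\<omega>. f (X i \<omega>, \<epsilon> i \<omega>)) \<longleftrightarrow> integrable M (\<lambda>\<omega>. f (X 1 \<omega>, \<epsilon> 1 \<omega>))"
    using identically_distributed[OF i] integrable_distr_eq[OF p(1) f']
      integrable_distr_eq[OF p(2) f'] by simp
qed

lemma integrable_inner_X: "i \<in> {1..n} \<Longrightarrow> integrable M (\<lambda>\<omega>. \<theta> \<bullet> X i \<omega>)"
  and expectation_inner_X: "i \<in> {1..n} \<Longrightarrow> expectation (\<lambda>\<omega>. \<theta> \<bullet> X i \<omega>) = 0"
  using identically_distributed_transfer[of i "\<lambda>p. \<theta> \<bullet> fst p"] X_integrable X_centred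
  by simp_all

lemma integrable_inner_X_mult:
    "i \<in> {1..n} \<Longrightarrow> integrable M (\<lambda>\<omega>. (\<theta> \<bullet> X i \<omega>) * (\<phi> \<bullet> X i \<omega>))"
  and expectation_inner_X_mult:
    "i \<in> {1..n} \<Longrightarrow> expectation (\<lambda>\<omega>. (\<theta> \<bullet> X i \<omega>) * (\<phi> \<bullet> X i \<omega>)) = \<theta> \<bullet> (H *v \<phi>)"
  using identically_distributed_transfer[of i "\<lambda>p. (\<theta> \<bullet> fst p) * (\<phi> \<bullet> fst p)"]
    integrable_bounded_linear[OF bounded_linear_inner_matrix_vector XX_integrable, of \<theta> \<phi>]
    integral_bounded_linear[OF bounded_linear_inner_matrix_vector XX_integrable, of \<theta> \<phi>]
  by (simp_all add: inner_outer_prod H)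

section \<open>The distribution function and pairwise comparisons\<close>

lemma F_eq: "F t = prob {\<omega> \<in> space M. Y 1 \<omega> \<le> t}"
  unfolding F cdf_def by (subst measure_distr) (auto intro: arg_cong[where f = prob])

lemma F_mono: "mono F"
  unfolding F_eq[abs_def] by (auto intro!: monoI finite_measure_mono)

lemma F_measurable [measurable]: "F \<in> borel_measurable borel"
  by (rule borel_measurable_mono[OF F_mono])

lemma F_bounds: "0 \<le> F t" "F t \<le> 1"
  by (auto simp: F_eq)

lemma expectation_le_eq_F:
  assumes j: "j \<in> {1..n}" shows "expectation (\<lambda>\<omega>. of_bool (Y j \<omega> \<le> t)) = F t"
proof -
  have "expectation (\<lambda>\<omega>. of_bool (Y j \<omega> \<le> t) :: real) =
      expectation (\<lambda>\<omega>. of_bool (Y 1 \<omega> \<le> t))"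
    unfolding model[OF j] model[OF one_mem]
    using identically_distributed_transfer(1)[OF j, of "\<lambda>p. of_bool (g (\<beta> \<bullet> fst p) (snd p) \<le> t)"]
    by simp
  also have "\<dots> = expectation (indicator {\<omega> \<in> space M. Y 1 \<omega> \<le> t})"
    by (intro Bochner_Integration.integral_cong) (auto simp: indicator_def)
  finally show ?thesis by (simp add: F_eq)
qed

text \<open>Distinct observations are independent, so Fubini averages over observation
  \<open>j\<close> first and turns the comparison into \<open>F (Y i)\<close>. Identical
  distribution then moves index \<open>i\<close> to 1.\<close>

lemma expectation_comparison_eq:
  assumes ij: "i \<in> {1..n}" "j \<in> {1..n}" "i \<noteq> j"
  shows "expectation (\<lambda>\<omega>. of_bool (Y j \<omega> \<le> Y i \<omega>) * (\<theta> \<bullet> X i \<omega>)) =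
    expectation (\<lambda>\<omega>. F (Y 1 \<omega>) * (\<theta> \<bullet> X 1 \<omega>))"
proof -
  let ?y = "\<lambda>p. g (\<beta> \<bullet> fst p) (snd p)" and ?W = "\<lambda>i \<omega>. (X i \<omega>, \<epsilon> i \<omega>)"
  \<comment> \<open>Here \<open>fst q\<close> holds the predictor and noise of observation
    \<open>i\<close>, and \<open>snd q\<close> those of observation \<open>j\<close>.\<close>
  let ?h = "\<lambda>q. of_bool (?y (snd q) \<le> ?y (fst q)) * (\<theta> \<bullet> fst (fst q))"
  have indep: "indep_rvs M (borel \<Otimes>\<^sub>M borel) (?W i) (borel \<Otimes>\<^sub>M borel) (?W j)"
    unfolding borel_prod by (rule indep_vars_indep_rvs[OF independent ij])
  have [measurable]: "X i \<in> borel_measurable M" "\<epsilon> i \<in> borel_measurable M"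
    "X j \<in> borel_measurable M" "\<epsilon> j \<in> borel_measurable M"
    using ij by auto
  have "integrable M (\<lambda>\<omega>. ?h (?W i \<omega>, ?W j \<omega>))"
    using ij by (intro integrable_bounded_mult[where C = 1]) (auto intro: integrable_inner_X)
  then have "expectation (\<lambda>\<omega>. ?h (?W i \<omega>, ?W j \<omega>)) = (\<integral>\<omega>. \<integral>\<omega>'. ?h (?W i \<omega>, ?W j \<omega>') \<partial>M \<partial>M)"
    by (intro indep_rvs_expectation[OF indep]) measurable
  also have "\<dots> = expectation (\<lambda>\<omega>. F (Y i \<omega>) * (\<theta> \<bullet> X i \<omega>))"
    using expectation_le_eq_F[of j] ij by (simp add: model)
  also have "\<dots> = expectation (\<lambda>\<omega>. F (Y 1 \<omega>) * (\<theta> \<bullet> X 1 \<omega>))"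
    using identically_distributed_transfer(1)[OF ij(1), of "\<lambda>p. F (?y p) * (\<theta> \<bullet> fst p)"] ij
    by (simp add: model)
  finally show ?thesis using ij by (simp add: model)
qed

lemma inner_\<mu>: "\<theta> \<bullet> \<mu> = expectation (\<lambda>\<omega>. F (Y 1 \<omega>) * (\<theta> \<bullet> X 1 \<omega>))"
proof -
  have "integrable M (\<lambda>\<omega>. of_bool (Y 2 \<omega> \<le> Y 1 \<omega>) *\<^sub>R X 1 \<omega>)"
  proof (rule Bochner_Integration.integrable_bound[OF X_integrable])
    show "(\<lambda>\<omega>. of_bool (Y 2 \<omega> \<le> Y 1 \<omega>) *\<^sub>R X 1 \<omega>) \<in> borel_measurable M"
      by measurable
  qed auto
  then have "\<theta> \<bullet> \<mu> = expectation (\<lambda>\<omega>. \<theta> \<bullet> (of_bool (Y 2 \<omega> \<le> Y 1 \<omega>) *\<^sub>R X 1 \<omega>))"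
    unfolding \<mu> by (intro integral_inner_right[symmetric]) auto
  then show ?thesis using expectation_comparison_eq[of 1 2 \<theta>] by simp
qed

section \<open>Centred ranks and the quadratic form of the expected loss\<close>

definition centred_rank :: "nat \<Rightarrow> 'a \<Rightarrow> real" where
  "centred_rank i \<omega> = real (sample_rank n (\<lambda>j. Y j \<omega>) i) / real n - 1 / 2"

lemma centred_rank_eq:
  "centred_rank i \<omega> = (\<Sum>j=1..n. of_bool (Y j \<omega> \<le> Y i \<omega>)) / real n - 1 / 2"
  by (simp add: centred_rank_def sample_rank_def)

lemma centred_rank_measurable [measurable]:
  "i \<in> {1..n} \<Longrightarrow> centred_rank i \<in> borel_measurable M"
  unfolding centred_rank_eq[abs_def] by measurable

text \<open>The rank divided by \<open>n\<close> is a fraction in [0, 1]. The crude bound 1 serves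
  only to obtain integrability.\<close>

lemma centred_rank_bound: "\<bar>centred_rank i \<omega>\<bar> \<le> 1"
proof -
  define s :: real where "s = (\<Sum>j=1..n. of_bool (Y j \<omega> \<le> Y i \<omega>))"
  have "s \<le> (\<Sum>j=1..n. 1)"
    unfolding s_def by (intro sum_mono) auto
  moreover have "0 \<le> s"
    unfolding s_def by (intro sum_nonneg) auto
  ultimately have "0 \<le> s / real n" "s / real n \<le> 1"
    by (auto simp: divide_le_eq_1)
  then show ?thesis
    unfolding centred_rank_eq s_def[symmetric] by linarith
qed

lemma expectation_centred_rank_inner_X:
  assumes i: "i \<in> {1..n}"
  shows "expectation (\<lambda>\<omega>. centred_rank i \<omega> * (\<theta> \<bullet> X i \<omega>)) = (real n - 1) / real n * (\<theta> \<bullet> \<mu>)"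
proof -
  have int: "integrable M (\<lambda>\<omega>. of_bool (Y j \<omega> \<le> Y i \<omega>) * (\<theta> \<bullet> X i \<omega>))" if "j \<in> {1..n}" for j
    using i that by (intro integrable_bounded_mult[where C = 1]) (auto intro: integrable_inner_X)
  have "expectation (\<lambda>\<omega>. centred_rank i \<omega> * (\<theta> \<bullet> X i \<omega>)) =
      expectation (\<lambda>\<omega>. (\<Sum>j=1..n. of_bool (Y j \<omega> \<le> Y i \<omega>) * (\<theta> \<bullet> X i \<omega>)) / real n
        - (\<theta> \<bullet> X i \<omega>) / 2)"
    \<comment> \<open>The deleted rules would turn sums of \<open>of_bool\<close> into cardinalities
      or filtered sums and destroy the termwise form needed for linearity.\<close>
    by (simp add: centred_rank_eq left_diff_distrib sum_distrib_right
        del: sum_of_bool_eq sum_of_bool_mult_eq sum_mult_of_bool_eq)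
  also have "\<dots> = expectation (\<lambda>\<omega>. (\<Sum>j=1..n. of_bool (Y j \<omega> \<le> Y i \<omega>) * (\<theta> \<bullet> X i \<omega>)) / real n)
      - expectation (\<lambda>\<omega>. (\<theta> \<bullet> X i \<omega>) / 2)"
    by (intro Bochner_Integration.integral_diff integrable_divide Bochner_Integration.integrable_sum
        int integrable_inner_X i)
  also have "\<dots> = (\<Sum>j=1..n. expectation (\<lambda>\<omega>. of_bool (Y j \<omega> \<le> Y i \<omega>) * (\<theta> \<bullet> X i \<omega>))) / real n"
    unfolding integral_divide_zero expectation_inner_X[OF i]
    by (subst Bochner_Integration.integral_sum) (simp_all only: int div_0 diff_0_right)
  \<comment> \<open>At \<open>j = i\<close> the comparison always holds and leaves a centred
    expectation, which is 0. The other \<open>n - 1\<close> terms are equal, whence the factor in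
    the result.\<close>
  also have "(\<Sum>j=1..n. expectation (\<lambda>\<omega>. of_bool (Y j \<omega> \<le> Y i \<omega>) * (\<theta> \<bullet> X i \<omega>))) =
      (\<Sum>j\<in>{1..n} - {i}. \<theta> \<bullet> \<mu>)"
    using i expectation_inner_X[OF i, of \<theta>] expectation_comparison_eq[of i _ \<theta>]
    by (subst sum.remove[of _ i]) (auto simp: inner_\<mu> intro!: sum.cong)
  also have "\<dots> = (real n - 1) * (\<theta> \<bullet> \<mu>)"
    using i n by (simp add: of_nat_diff)
  finally show ?thesis by simp
qed

text \<open>Each square is expanded into a rank term free of \<theta>, a cross term and a second
  moment. The last two have the same expectation for every \<open>i\<close>, so the factor
  \<open>1 / (2 * real n)\<close> averages them.\<close>

lemma expected_rank_loss:
  "expectation (\<lambda>\<omega>. rank_loss n (\<lambda>i. X i \<omega>) (\<lambda>i. Y i \<omega>) \<theta>) =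
     (\<Sum>i=1..n. expectation (\<lambda>\<omega>. (centred_rank i \<omega>)\<^sup>2)) / (2 * real n)
     - (real n - 1) / real n * (\<theta> \<bullet> \<mu>) + \<theta> \<bullet> (H *v \<theta>) / 2"
proof -
  let ?f = "\<lambda>i \<omega>. (centred_rank i \<omega> - \<theta> \<bullet> X i \<omega>)\<^sup>2"
  have *: "integrable M (?f i) \<and> expectation (?f i) =
      expectation (\<lambda>\<omega>. (centred_rank i \<omega>)\<^sup>2) - 2 * ((real n - 1) / real n * (\<theta> \<bullet> \<mu>)) + \<theta> \<bullet> (H *v \<theta>)"
    if i: "i \<in> {1..n}" for i
  proof -
    have 1: "integrable M (\<lambda>\<omega>. (centred_rank i \<omega>)\<^sup>2)"
      using i centred_rank_bound[of i]
      by (intro integrable_const_bound[of _ 1]) (auto simp: abs_square_le_1)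
    have 2: "integrable M (\<lambda>\<omega>. centred_rank i \<omega> * (\<theta> \<bullet> X i \<omega>))"
      using i centred_rank_bound[of i] by (intro integrable_bounded_mult integrable_inner_X) auto
    have f: "?f i = (\<lambda>\<omega>. (centred_rank i \<omega>)\<^sup>2 - 2 * (centred_rank i \<omega> * (\<theta> \<bullet> X i \<omega>))
        + (\<theta> \<bullet> X i \<omega>) * (\<theta> \<bullet> X i \<omega>))"
      by (auto simp: power2_eq_square algebra_simps)
    show ?thesis
      unfolding f using 1 2 integrable_inner_X_mult[OF i, of \<theta> \<theta>] i
      by (simp add: expectation_inner_X_mult expectation_centred_rank_inner_X)
  qed
  have "expectation (\<lambda>\<omega>. rank_loss n (\<lambda>i. X i \<omega>) (\<lambda>i. Y i \<omega>) \<theta>) =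
      1 / (2 * real n) * (\<Sum>i=1..n. expectation (?f i))"
    using * by (simp add: rank_loss_def flip: centred_rank_def)
  also have "\<dots> = 1 / (2 * real n) * (\<Sum>i=1..n. expectation (\<lambda>\<omega>. (centred_rank i \<omega>)\<^sup>2)
      - 2 * ((real n - 1) / real n * (\<theta> \<bullet> \<mu>)) + \<theta> \<bullet> (H *v \<theta>))"
    using * by simp
  also have "\<dots> = (\<Sum>i=1..n. expectation (\<lambda>\<omega>. (centred_rank i \<omega>)\<^sup>2)) / (2 * real n)
     - (real n - 1) / real n * (\<theta> \<bullet> \<mu>) + \<theta> \<bullet> (H *v \<theta>) / 2"
  proof -
    have "1 / (2 * real n) * (s - real n * (2 * k) + real n * q) = s / (2 * real n) - k + q / 2"
      for s k q :: real
      by (simp add: add_divide_distrib diff_divide_distrib)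
    then show ?thesis
      by (simp only: sum.distrib sum_subtractf sum_constant card_atLeastAtMost diff_Suc_1)
  qed
  finally show ?thesis .
qed

lemma inner_\<beta>_\<mu>_covariance:
  "\<beta> \<bullet> \<mu> = covariance M (\<lambda>\<omega>. F (Y 1 \<omega>)) (\<lambda>\<omega>. \<beta> \<bullet> X 1 \<omega>)"
proof -
  have "integrable M (\<lambda>\<omega>. F (Y 1 \<omega>) * (\<beta> \<bullet> X 1 \<omega>))"
    using F_bounds by (intro integrable_bounded_mult[where C = 1] integrable_inner_X) auto
  \<comment> \<open>Centring of the index removes the product of the two means.\<close>
  then show ?thesis
    by (simp add: covariance_def inner_\<mu> expectation_inner_X integrable_inner_X left_diff_distrib)
qed

text \<open>Averaging out the noise replaces \<open>F (Y 1)\<close> by a function of the index \<open>\<beta> \<bullet> X 1\<close>, against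
  which \<open>\<theta> \<bullet> X 1\<close> may be replaced by its conditional expectation.\<close>

lemma \<mu>_proportional:
  assumes lin: "AE \<omega> in M. cond_exp_given M (\<lambda>\<omega>. \<theta> \<bullet> X 1 \<omega>) (\<lambda>\<omega>. \<beta> \<bullet> X 1 \<omega>) \<omega> = d * (\<beta> \<bullet> X 1 \<omega>)"
  shows "\<theta> \<bullet> \<mu> = d * (\<beta> \<bullet> \<mu>)" and "\<theta> \<bullet> (H *v \<beta>) = d * (\<beta> \<bullet> (H *v \<beta>))"
proof -
  \<comment> \<open>The mean of \<open>F (Y 1)\<close> when the index is held at \<open>t\<close>
    and only the noise is random.\<close>
  define m where "m t = expectation (\<lambda>\<omega>. F (g t (\<epsilon> 1 \<omega>)))" for t
  have m_measurable [measurable]: "m \<in> borel_measurable borel"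
    unfolding m_def by measurable
  have m_bound: "\<bar>m t\<bar> \<le> 1" for t
  proof -
    have "0 \<le> m t" unfolding m_def using F_bounds by simp
    moreover have "m t \<le> expectation (\<lambda>_. 1)"
      unfolding m_def using F_bounds
      by (intro integral_mono integrable_const_bound[of _ 1]) auto
    ultimately show ?thesis by (simp add: prob_space)
  qed
  have inner: "\<phi> \<bullet> \<mu> = expectation (\<lambda>\<omega>. m (\<beta> \<bullet> X 1 \<omega>) * (\<phi> \<bullet> X 1 \<omega>))" for \<phi>
  proof -
    let ?h = "\<lambda>q. F (g (\<beta> \<bullet> fst q) (snd q)) * (\<phi> \<bullet> fst q)"
    have "integrable M (\<lambda>\<omega>. ?h (X 1 \<omega>, \<epsilon> 1 \<omega>))"
      using F_bounds by (intro integrable_bounded_mult[where C = 1]) (auto intro: integrable_inner_X)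
    then have "expectation (\<lambda>\<omega>. ?h (X 1 \<omega>, \<epsilon> 1 \<omega>)) = (\<integral>\<omega>. \<integral>\<omega>'. ?h (X 1 \<omega>, \<epsilon> 1 \<omega>') \<partial>M \<partial>M)"
      by (intro indep_rvs_expectation[OF X_noise_indep]) measurable
    then show ?thesis by (simp add: inner_\<mu> model m_def)
  qed
  have "integrable M (\<lambda>\<omega>. m (\<beta> \<bullet> X 1 \<omega>) * (\<theta> \<bullet> X 1 \<omega>))"
    using m_bound by (intro integrable_bounded_mult integrable_inner_X) auto
  then have "\<theta> \<bullet> \<mu> = expectation (\<lambda>\<omega>. m (\<beta> \<bullet> X 1 \<omega>) * (d * (\<beta> \<bullet> X 1 \<omega>)))"
    unfolding inner by (intro cond_exp_given_expectation[OF _ _ m_measurable _ lin]) auto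
  also have "\<dots> = d * (\<beta> \<bullet> \<mu>)"
    unfolding inner by (simp add: mult.left_commute[of _ d])
  finally show "\<theta> \<bullet> \<mu> = d * (\<beta> \<bullet> \<mu>)" .
  \<comment> \<open>The same substitution with the index itself as weight in place of
    \<open>m\<close>; this is why the same \<open>d\<close> appears in both claims.\<close>
  have "expectation (\<lambda>\<omega>. (\<beta> \<bullet> X 1 \<omega>) * (\<theta> \<bullet> X 1 \<omega>)) =
      expectation (\<lambda>\<omega>. (\<beta> \<bullet> X 1 \<omega>) * (d * (\<beta> \<bullet> X 1 \<omega>)))"
    using integrable_inner_X_mult[of 1 \<beta> \<theta>]
    by (intro cond_exp_given_expectation[where \<phi> = "\<lambda>x. x", OF _ _ _ _ lin]) auto
  also have "\<dots> = d * expectation (\<lambda>\<omega>. (\<beta> \<bullet> X 1 \<omega>) * (\<beta> \<bullet> X 1 \<omega>))"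
    by (simp add: mult.left_commute[of _ d])
  also have "expectation (\<lambda>\<omega>. (\<beta> \<bullet> X 1 \<omega>) * (\<theta> \<bullet> X 1 \<omega>)) =
      expectation (\<lambda>\<omega>. (\<theta> \<bullet> X 1 \<omega>) * (\<beta> \<bullet> X 1 \<omega>))"
    by (intro Bochner_Integration.integral_cong refl mult.commute)
  finally show "\<theta> \<bullet> (H *v \<beta>) = d * (\<beta> \<bullet> (H *v \<beta>))"
    by (simp only: expectation_inner_X_mult[OF one_mem])
qed

lemma inner_\<beta>_\<mu>_pos:
  assumes F: "strict_mono F" and g: "\<And>e. strict_mono (\<lambda>t. g t e)"
    and H: "\<beta> \<bullet> (H *v \<beta>) > 0"
  shows "\<beta> \<bullet> \<mu> > 0"
proof -
  let ?Z = "\<lambda>\<omega>. \<beta> \<bullet> X 1 \<omega>"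
  \<comment> \<open>Subtracting the value at index 0 makes the first factor share the sign of
    \<open>?Z\<close>, since \<open>F (g t e)\<close> is strictly increasing in
    \<open>t\<close>.\<close>
  let ?D = "\<lambda>\<omega>. (F (g (?Z \<omega>) (\<epsilon> 1 \<omega>)) - F (g 0 (\<epsilon> 1 \<omega>))) * ?Z \<omega>"
  have mono: "strict_mono (\<lambda>t. F (g t e))" for e
    using F g by (auto simp: strict_mono_def)
  have pos: "?D \<omega> > 0" if "?Z \<omega> \<noteq> 0" for \<omega>
    using that strict_mono_less[OF mono, of "?Z \<omega>" "\<epsilon> 1 \<omega>" 0]
      strict_mono_less[OF mono, of 0 "\<epsilon> 1 \<omega>" "?Z \<omega>"]
    by (auto simp: zero_less_mult_iff linorder_neq_iff)
  have nonneg: "?D \<omega> \<ge> 0" for \<omega>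
    using pos[of \<omega>] by (cases "?Z \<omega> = 0") auto
  have int: "integrable M (\<lambda>\<omega>. F (g (?Z \<omega>) (\<epsilon> 1 \<omega>)) * ?Z \<omega>)"
    "integrable M (\<lambda>\<omega>. F (g 0 (\<epsilon> 1 \<omega>)) * ?Z \<omega>)"
    using F_bounds by (auto intro!: integrable_bounded_mult[where C = 1] integrable_inner_X)
  then have intD: "integrable M ?D" by (simp add: left_diff_distrib)
  \<comment> \<open>The subtracted term has expectation 0: by independence its noise factor averages
    to a constant, and the index is centred.\<close>
  have "expectation (\<lambda>\<omega>. F (g 0 (\<epsilon> 1 \<omega>)) * ?Z \<omega>) =
      (\<integral>\<omega>. \<integral>\<omega>'. F (g 0 (\<epsilon> 1 \<omega>')) * ?Z \<omega> \<partial>M \<partial>M)"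
    using indep_rvs_expectation[OF X_noise_indep, of "\<lambda>q. F (g 0 (snd q)) * (\<beta> \<bullet> fst q)"] int
    by simp
  also have "\<dots> = 0" by (simp add: expectation_inner_X)
  finally have eq: "\<beta> \<bullet> \<mu> = expectation ?D"
    using int by (simp add: inner_\<mu> model left_diff_distrib)
  \<comment> \<open>A vanishing integral of the nonnegative \<open>?D\<close> would force the index
    to be 0 almost everywhere, hence its second moment
    \<open>\<beta> \<bullet> (H *v \<beta>)\<close> to be 0.\<close>
  have "expectation ?D \<noteq> 0"
  proof
    assume "expectation ?D = 0"
    then have "AE \<omega> in M. ?D \<omega> = 0"
      using integral_nonneg_eq_0_iff_AE[OF intD] nonneg by simp
    then have "AE \<omega> in M. ?Z \<omega> = 0"
      by (rule eventually_mono) (metis pos less_irrefl)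
    then have "expectation (\<lambda>\<omega>. ?Z \<omega> * ?Z \<omega>) = expectation (\<lambda>_. 0)"
      by (intro integral_cong_AE) auto
    then show False using H expectation_inner_X_mult[of 1 \<beta> \<beta>] by simp
  qed
  moreover have "expectation ?D \<ge> 0" using nonneg by simp
  ultimately show ?thesis unfolding eq by simp
qed

end


section \<open>Minimisation\<close>

text \<open>Completing the square: the excess of \<open>E v\<close> over \<open>E \<eta>\<close> is
  half the quadratic form at \<open>v - \<eta>\<close>. Symmetry of \<open>H\<close> merges the
  cross terms, and writing the linear coefficient as \<open>H *v \<eta>\<close> avoids an inverse
  matrix.\<close>

lemma pos_definite_quadratic_arg_min:
  fixes H :: "real ^ 'p ^ 'p" and E :: "real ^ 'p \<Rightarrow> real"
  assumes H: "pos_definite H"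
    and E: "\<And>\<theta>. E \<theta> = c - \<theta> \<bullet> (H *v \<eta>) + \<theta> \<bullet> (H *v \<theta>) / 2"
  shows "is_arg_min E (\<lambda>_. True) \<theta> \<longleftrightarrow> \<theta> = \<eta>"
proof -
  have transpose: "transpose H = H"
    using H unfolding pos_definite_def by blast
  have sym: "\<eta> \<bullet> (H *v v) = v \<bullet> (H *v \<eta>)" for v
  proof -
    have "\<eta> \<bullet> (H *v v) = (transpose H *v \<eta>) \<bullet> v"
      by (simp only: dot_lmul_matrix transpose_matrix_vector)
    also have "\<dots> = v \<bullet> (H *v \<eta>)"
      unfolding transpose by (rule inner_commute)
    finally show ?thesis .
  qed
  have "E v - E \<eta> = (v - \<eta>) \<bullet> (H *v (v - \<eta>)) / 2" for v
    by (simp add: E matrix_vector_mult_diff_distrib inner_diff_left inner_diff_right sym[of v]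
        diff_divide_distrib)
  then have "E \<eta> < E v" if "v \<noteq> \<eta>" for v
    using H that unfolding pos_definite_def
    by (metis diff_gt_0_iff_gt half_gt_zero right_minus_eq)
  then show ?thesis
    unfolding is_arg_min_def by (metis less_asym)
qed

theorem theorem1:
  fixes M :: "'a measure" and n :: nat
    and X :: "nat \<Rightarrow> 'a \<Rightarrow> real ^ 'p" and \<epsilon> Y :: "nat \<Rightarrow> 'a \<Rightarrow> real"
    and g :: "real \<Rightarrow> real \<Rightarrow> real"
    and \<beta> \<theta>\<^sub>0 \<mu> :: "real ^ 'p" and H :: "real ^ 'p ^ 'p"
    and EQ :: "real ^ 'p \<Rightarrow> real" and F :: "real \<Rightarrow> real" and \<gamma> :: real
  assumes prob_space: "prob_space M"
    and n: "n \<ge> 2"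
    and \<beta>_nonzero: "\<beta> \<noteq> 0"
    and g_measurable: "(\<lambda>(t, e). g t e) \<in> borel_measurable borel"
    and model: "\<And>i \<omega>. i \<in> {1..n} \<Longrightarrow> Y i \<omega> = g (\<beta> \<bullet> X i \<omega>) (\<epsilon> i \<omega>)"
    and independent:
      "prob_space.indep_vars M (\<lambda>_. borel) (\<lambda>i \<omega>. (X i \<omega>, \<epsilon> i \<omega>)) {1..n}"
    and identically_distributed:
      "\<And>i. i \<in> {1..n} \<Longrightarrow>
         distr M borel (\<lambda>\<omega>. (X i \<omega>, \<epsilon> i \<omega>)) = distr M borel (\<lambda>\<omega>. (X 1 \<omega>, \<epsilon> 1 \<omega>))"
    and X_abs_cont: "absolutely_continuous lborel (distr M borel (X 1))"
    and X_noise_indep: "indep_rvs M borel (X 1) borel (\<epsilon> 1)"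
    and X_integrable: "integrable M (X 1)"
    and X_centred: "(\<integral>\<omega>. X 1 \<omega> \<partial>M) = 0"
    and XX_integrable: "integrable M (\<lambda>\<omega>. outer_prod (X 1 \<omega>) (X 1 \<omega>))"
    and H: "H = (\<integral>\<omega>. outer_prod (X 1 \<omega>) (X 1 \<omega>) \<partial>M)"
    and H_pos_definite: "pos_definite H"
    and H_diagonal: "\<And>j. H $ j $ j = 1"
    and linear_cond_exp:
      "\<And>\<theta> :: real ^ 'p. integrable M (\<lambda>\<omega>. \<theta> \<bullet> X 1 \<omega>) \<and>
         (\<exists>d :: real. AE \<omega> in M.
            cond_exp_given M (\<lambda>\<omega>. \<theta> \<bullet> X 1 \<omega>) (\<lambda>\<omega>. \<beta> \<bullet> X 1 \<omega>) \<omega> = d * (\<beta> \<bullet> X 1 \<omega>))"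
    and EQ: "\<And>\<theta>. EQ \<theta> = (\<integral>\<omega>. rank_loss n (\<lambda>i. X i \<omega>) (\<lambda>i. Y i \<omega>) \<theta> \<partial>M)"
    and \<theta>\<^sub>0: "\<theta>\<^sub>0 = arg_min EQ (\<lambda>_. True)"
    and \<mu>: "\<mu> = (\<integral>\<omega>. of_bool (Y 2 \<omega> \<le> Y 1 \<omega>) *\<^sub>R X 1 \<omega> \<partial>M)"
    and F: "F = cdf (distr M borel (Y 1))"
    and \<gamma>: "\<gamma> = ((real n - 1) / real n * (\<beta> \<bullet> \<mu>)) / (\<beta> \<bullet> (H *v \<beta>))"
  shows "(\<exists>!\<theta>. is_arg_min EQ (\<lambda>_. True) \<theta>) \<and>
         \<theta>\<^sub>0 = \<gamma> *\<^sub>R \<beta> \<and>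
         \<gamma> = ((real n - 1) / real n * covariance M (\<lambda>\<omega>. F (Y 1 \<omega>)) (\<lambda>\<omega>. \<beta> \<bullet> X 1 \<omega>))
               / (\<beta> \<bullet> (H *v \<beta>)) \<and>
         (strict_mono F \<and> (\<forall>e. strict_mono (\<lambda>t. g t e)) \<longrightarrow>
            \<gamma> > 0 \<and> (\<forall>j. sgn (\<beta> $ j) = sgn (\<theta>\<^sub>0 $ j)) \<and>
            {j. \<beta> $ j \<noteq> 0} = {j. \<theta>\<^sub>0 $ j \<noteq> 0})"
proof -
  interpret prob_space M by fact
  interpret single_index_sample M n X \<epsilon> Y g \<beta> \<mu> H F
    by unfold_locales (fact+)
  have \<beta>H\<beta>: "\<beta> \<bullet> (H *v \<beta>) > 0"
    using H_pos_definite \<beta>_nonzero by (simp add: pos_definite_def)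
  \<comment> \<open>The linear term of the loss is matched with \<open>H *v \<eta>\<close> for
    \<open>\<eta> = \<gamma> *\<^sub>R \<beta>\<close>. Both sides carry the same factor
    \<open>d\<close>, and what remains is the quotient defining \<gamma>, with positive
    denominator.\<close>
  have proportional: "(real n - 1) / real n * (\<theta> \<bullet> \<mu>) = \<theta> \<bullet> (H *v (\<gamma> *\<^sub>R \<beta>))" for \<theta>
  proof -
    obtain d where "AE \<omega> in M. cond_exp_given M (\<lambda>\<omega>. \<theta> \<bullet> X 1 \<omega>) (\<lambda>\<omega>. \<beta> \<bullet> X 1 \<omega>) \<omega>
        = d * (\<beta> \<bullet> X 1 \<omega>)"
      using linear_cond_exp[of \<theta>] by blast
    note d = \<mu>_proportional[OF this]
    show ?thesis
      using \<beta>H\<beta> by (simp add: matrix_vector_mult_scaleR d \<gamma>)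
  qed
  have arg_min: "is_arg_min EQ (\<lambda>_. True) \<theta> \<longleftrightarrow> \<theta> = \<gamma> *\<^sub>R \<beta>" for \<theta>
    using H_pos_definite
    by (rule pos_definite_quadratic_arg_min) (simp only: EQ expected_rank_loss proportional)
  \<comment> \<open>\<open>arg_min\<close> is a choice among minimisers; the equivalence just shown
    supplies existence and leaves a single candidate.\<close>
  then have \<theta>\<^sub>0_eq: "\<theta>\<^sub>0 = \<gamma> *\<^sub>R \<beta>"
    unfolding \<theta>\<^sub>0 arg_min_def by (metis someI)
  have "\<gamma> > 0" if "strict_mono F" "\<And>e. strict_mono (\<lambda>t. g t e)"
    unfolding \<gamma> using inner_\<beta>_\<mu>_pos[OF that \<beta>H\<beta>] \<beta>H\<beta> n_ge(2)
    by (intro divide_pos_pos mult_pos_pos) simp_all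
  \<comment> \<open>Scaling by a positive number preserves the sign of each coordinate, and so the
    support.\<close>
  then have "strict_mono F \<and> (\<forall>e. strict_mono (\<lambda>t. g t e)) \<longrightarrow>
      \<gamma> > 0 \<and> (\<forall>j. sgn (\<beta> $ j) = sgn (\<theta>\<^sub>0 $ j)) \<and> {j. \<beta> $ j \<noteq> 0} = {j. \<theta>\<^sub>0 $ j \<noteq> 0}"
    by (auto simp: \<theta>\<^sub>0_eq sgn_mult)
  moreover have "\<exists>!\<theta>. is_arg_min EQ (\<lambda>_. True) \<theta>"
    using arg_min by simp
  ultimately show ?thesis
    using \<theta>\<^sub>0_eq \<gamma>[unfolded inner_\<beta>_\<mu>_covariance] by blast
qed

end
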